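(* Let $k$ be a positive integer. As formal power series, $$B_k(x)=\frac{E_k(x)}{k+1-k\cdot E_k(x)}.$$
   Context: All paths are lattice paths in $\mathbb{Z}^2$ composed only of unit steps to the right $(1,0)$ and up $(0,1)$. For $n\ge 0$, $b_k(n)=\binom{kn+n}{n}$ is the number of bridges of size $n$, i.e. of paths from $(0,0)$ to $(kn,n)$, and $e_k(n)$ is the number of excursions of size $n$, i.e. of paths from $(0,0)$ to $(kn,n)$ staying weakly above the line $y=x/k$; these are the $k$-Catalan numbers $e_k(n)=\frac{1}{kn+1}\binom{kn+n}{n}$. The ordinary generating functions are $$B_k(x)=\sum_{n\ge 0} b_k(n)x^n=\sum_{n\ge0}\binom{kn+n}{n}x^n,\qquad E_k(x)=\sum_{n\ge 0} e_k(n)x^n=\sum_{n\ge0}\frac{1}{kn+1}\binom{kn+n}{n}x^n.$$ *)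

theory Defs
  imports
    Complex_Main
    "HOL-Library.Product_Plus"
    "HOL-Computational_Algebra.Formal_Power_Series"
begin

text \<open>A lattice path starting at the origin is represented by the list of its steps; the point
  reached after the first \<open>m\<close> steps is \<open>sum_list (take m p)\<close>.\<close>

definition lattice_path :: "(int \<times> int) list \<Rightarrow> bool" where
  "lattice_path p \<longleftrightarrow> set p \<subseteq> {(1, 0), (0, 1)}"

definition bridges :: "nat \<Rightarrow> nat \<Rightarrow> (int \<times> int) list set" where
  "bridges k n = {p. lattice_path p \<and> sum_list p = (int (k * n), int n)}"

text \<open>Since a half-plane is convex, a path stays weakly above the line \<open>y = x / k\<close> iff all its
  lattice points do. The definition is only meant for \<open>k > 0\<close>.\<close>

definition weakly_above :: "nat \<Rightarrow> (int \<times> int) list \<Rightarrow> bool" where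
  "weakly_above k p \<longleftrightarrow>
     (\<forall>m \<le> length p. case sum_list (take m p) of (x, y) \<Rightarrow> real_of_int y \<ge> real_of_int x / real k)"

definition excursions :: "nat \<Rightarrow> nat \<Rightarrow> (int \<times> int) list set" where
  "excursions k n = {p \<in> bridges k n. weakly_above k p}"

definition bridge_count :: "nat \<Rightarrow> nat \<Rightarrow> nat" where
  "bridge_count k n = card (bridges k n)"

definition excursion_count :: "nat \<Rightarrow> nat \<Rightarrow> nat" where
  "excursion_count k n = card (excursions k n)"

definition bridge_gf :: "nat \<Rightarrow> rat fps" where
  "bridge_gf k = Abs_fps (\<lambda>n. of_nat (bridge_count k n))"

definition excursion_gf :: "nat \<Rightarrow> rat fps" where
  "excursion_gf k = Abs_fps (\<lambda>n. of_nat (excursion_count k n))"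

end

theory Submission
  imports Defs
begin

text \<open>Cutting a path from the origin to \<open>(k n + 1, n)\<close> at the first step that crosses the line
  \<open>x = k y\<close> yields an excursion and a bridge, so the coefficients of \<open>E B\<close> are
  \<open>binomial(k n + n + 1, n)\<close>. On the other hand, excursions are the bridges all of whose suffixes
  \<open>(x, y)\<close> satisfy \<open>k y \<le> x\<close>; the number of paths to \<open>(a, b)\<close> with this property obeys Pascal's
  recursion and vanishes for \<open>a + 1 = k b\<close>, which gives
  \<open>e(n) = binomial(k n + n, n) - k binomial(k n + n, n - 1)\<close>. Pascal's rule now shows
  \<open>(k + 1) B = E + k E B\<close>.\<close>

section \<open>Lattice paths with a given endpoint\<close>

definition paths :: "nat \<Rightarrow> nat \<Rightarrow> (int \<times> int) list set" where
  "paths a b = {p. lattice_path p \<and> sum_list p = (int a, int b)}"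

lemma bridges_eq_paths: "bridges k n = paths (k * n) n"
  by (simp add: bridges_def paths_def)

lemma lattice_path_simps [simp]:
  "lattice_path []"
  "lattice_path (s # p) \<longleftrightarrow> (s = (1, 0) \<or> s = (0, 1)) \<and> lattice_path p"
  "lattice_path (p @ q) \<longleftrightarrow> lattice_path p \<and> lattice_path q"
  by (auto simp: lattice_path_def)

lemma lattice_path_take: "lattice_path p \<Longrightarrow> lattice_path (take m p)"
  and lattice_path_drop: "lattice_path p \<Longrightarrow> lattice_path (drop m p)"
  by (auto simp: lattice_path_def dest: in_set_takeD in_set_dropD)

lemma lattice_path_in_paths:
  assumes "lattice_path p"
  obtains a b where "p \<in> paths a b"
proof -
  have "\<exists>a b. p \<in> paths a b"
    using assms
  proof (induction p)
    case Nil
    have "[] \<in> paths 0 0" by (simp add: paths_def zero_prod_def)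
    then show ?case by blast
  next
    case (Cons s p)
    then obtain a b where "p \<in> paths a b" by auto
    with Cons.prems have "s # p \<in> paths (Suc a) b \<or> s # p \<in> paths a (Suc b)"
      by (auto simp: paths_def)
    then show ?case by blast
  qed
  with that show thesis by blast
qed

lemma Nil_in_paths_iff [simp]: "[] \<in> paths a b \<longleftrightarrow> a = 0 \<and> b = 0"
  by (auto simp: paths_def zero_prod_def)

lemma Cons_in_paths_iff:
  "s # p \<in> paths a b \<longleftrightarrow>
     s = (1, 0) \<and> a > 0 \<and> p \<in> paths (a - 1) b \<or> s = (0, 1) \<and> b > 0 \<and> p \<in> paths a (b - 1)"
  (is "?L \<longleftrightarrow> ?R")
proof
  assume L: ?L
  then have "lattice_path p" by (simp add: paths_def)
  then obtain a' b' where "p \<in> paths a' b'" by (rule lattice_path_in_paths)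
  with L show ?R by (auto simp: paths_def plus_prod_def prod_eq_iff)
next
  assume ?R
  then show ?L by (auto simp: paths_def plus_prod_def prod_eq_iff)
qed

lemma paths_rec:
  "paths a b = (if a = 0 \<and> b = 0 then {[]} else {})
     \<union> (if a > 0 then Cons (1, 0) ` paths (a - 1) b else {})
     \<union> (if b > 0 then Cons (0, 1) ` paths a (b - 1) else {})"
  (is "_ = ?R")
proof (rule set_eqI)
  show "p \<in> paths a b \<longleftrightarrow> p \<in> ?R" for p
    by (cases p) (auto simp: Cons_in_paths_iff)
qed

lemma finite_paths [simp]: "finite (paths a b)"
proof (induction "a + b" arbitrary: a b rule: less_induct)
  case less
  then show ?case by (subst paths_rec) auto
qed

lemma card_Cons_image_Un:
  assumes "finite A" "finite B" "s \<noteq> t"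
  shows "card (Cons s ` A \<union> Cons t ` B) = card A + card B"
  using assms by (subst card_Un_disjoint) (auto simp: card_image)

text \<open>Splitting off the first step is Pascal's rule; on the axes only one branch
  survives.\<close>

lemma card_paths: "card (paths a b) = (a + b) choose b"
proof (induction "a + b" arbitrary: a b rule: less_induct)
  case less
  show ?case
  proof (cases a; cases b)
    fix a' b' assume "a = Suc a'" "b = Suc b'"
    then show ?thesis
      using less[of a' b] less[of a b']
      by (subst paths_rec) (simp add: card_Cons_image_Un)
  next
    fix a' assume "a = Suc a'" "b = 0"
    then show ?thesis using less[of a' b] by (subst paths_rec) (simp add: card_image)
  next
    fix b' assume "a = 0" "b = Suc b'"
    then show ?thesis using less[of a b'] by (subst paths_rec) (simp add: card_image)
  qed (subst paths_rec, simp)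
qed

section \<open>Paths under a suffix condition: a ballot count\<close>

text \<open>Suffixes are constrained rather than prefixes because lists grow at the head: a
  prepended step creates just one new suffix, the whole path.\<close>

definition suffix_paths :: "nat \<Rightarrow> nat \<Rightarrow> nat \<Rightarrow> (int \<times> int) list set" where
  "suffix_paths k a b = {p \<in> paths a b.
     \<forall>m \<le> length p. int k * snd (sum_list (drop m p)) \<le> fst (sum_list (drop m p))}"

lemma finite_suffix_paths [simp]: "finite (suffix_paths k a b)"
  by (simp add: suffix_paths_def)

text \<open>The whole path is its own suffix (\<open>m = 0\<close>), so the endpoint itself must
  satisfy the condition.\<close>

lemma suffix_paths_empty:
  assumes "a < k * b"
  shows "suffix_paths k a b = {}"
proof -
  have False if "p \<in> suffix_paths k a b" for p
  proof -
    from that have "int k * int b \<le> int a"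
      by (auto simp: suffix_paths_def paths_def dest!: spec[of _ 0])
    then have "k * b \<le> a" by (metis of_nat_le_iff of_nat_mult)
    with assms show False by simp
  qed
  then show ?thesis by blast
qed

lemma all_le_Suc_iff: "(\<forall>m \<le> Suc n. P m) \<longleftrightarrow> P 0 \<and> (\<forall>m \<le> n. P (Suc m))"
  by (metis Suc_le_mono le0 not0_implies_Suc)

text \<open>The hypothesis is exactly the condition on the one new suffix; all other suffixes belong
  to \<open>p\<close>.\<close>

lemma Cons_in_suffix_paths_iff:
  assumes "k * b \<le> a"
  shows "s # p \<in> suffix_paths k a b \<longleftrightarrow>
     s = (1, 0) \<and> a > 0 \<and> p \<in> suffix_paths k (a - 1) b \<or>
     s = (0, 1) \<and> b > 0 \<and> p \<in> suffix_paths k a (b - 1)"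
proof (cases "s # p \<in> paths a b")
  case True
  from assms have "int k * int b \<le> int a" by (metis of_nat_le_iff of_nat_mult)
  moreover from True have "s + sum_list p = (int a, int b)" by (simp add: paths_def)
  ultimately show ?thesis using True
    by (auto simp: suffix_paths_def all_le_Suc_iff Cons_in_paths_iff)
next
  case False
  then show ?thesis by (auto simp: suffix_paths_def Cons_in_paths_iff)
qed

lemma suffix_paths_rec:
  assumes "k * b \<le> a"
  shows "suffix_paths k a b = (if a = 0 \<and> b = 0 then {[]} else {})
     \<union> (if a > 0 then Cons (1, 0) ` suffix_paths k (a - 1) b else {})
     \<union> (if b > 0 then Cons (0, 1) ` suffix_paths k a (b - 1) else {})"
  (is "_ = ?R")
proof (rule set_eqI)
  have "[] \<in> suffix_paths k a b \<longleftrightarrow> a = 0 \<and> b = 0"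
    by (auto simp: suffix_paths_def)
  then show "p \<in> suffix_paths k a b \<longleftrightarrow> p \<in> ?R" for p
    by (cases p) (auto simp: Cons_in_suffix_paths_iff[OF assms])
qed

text \<open>Both sides obey Pascal's recursion where \<open>k * b \<le> a\<close>. The range extends
  to \<open>k * b = a + 1\<close>, where the set is empty, because the recursion reaches that
  boundary. The formula is additive to avoid truncated subtraction, and \<open>b = 0\<close> is
  separate because \<open>b - 1\<close> would truncate to 0.\<close>

lemma card_suffix_paths:
  assumes "k > 0" "k * b \<le> a + 1"
  shows "card (suffix_paths k a b) + (if b = 0 then 0 else k * ((a + b) choose (b - 1)))
    = (a + b) choose b"
  using assms(2)
proof (induction "a + b" arbitrary: a b rule: less_induct)
  case less
  show ?case
  proof (cases b)
    case 0
    then show ?thesis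
      using less(1)[of "a - 1" b] by (subst suffix_paths_rec) (auto simp: card_image)
  next
    case (Suc b')
    show ?thesis
    proof (cases "k * b = a + 1")
      case True
      \<comment> \<open>Absorption with \<open>N = a + b\<close>: the factor \<open>N - b'\<close>
        equals \<open>a + 1\<close>, which on this boundary is \<open>k * Suc b'\<close>.\<close>
      have "Suc b' * ((a + b) choose Suc b') = (a + 1) * ((a + b) choose b')"
        using binomial_absorb_comp[of "a + b" b'] binomial_absorption[of b' "a + b"] Suc
        by (simp del: binomial_Suc_Suc)
      also have "\<dots> = Suc b' * (k * ((a + b) choose b'))"
        using True Suc by (metis mult.assoc mult.commute)
      finally have "(a + b) choose Suc b' = k * ((a + b) choose b')"
        by (metis mult_cancel1 nat.distinct(1))
      then show ?thesis using True Suc by (simp add: suffix_paths_empty)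
    next
      case False
      with less.prems have le: "k * b \<le> a" by simp
      with Suc \<open>k > 0\<close> obtain a' where a: "a = Suc a'" by (cases a) auto
      from le Suc have le': "k * b' \<le> a" by simp
      have "card (suffix_paths k a b) = card (suffix_paths k a' b) + card (suffix_paths k a b')"
        using le a Suc by (subst suffix_paths_rec) (auto simp: card_Cons_image_Un)
      \<comment> \<open>If \<open>k * b = a\<close>, then \<open>(a', b)\<close> lies on the
        boundary \<open>k * b = a' + 1\<close>, still covered by the induction hypothesis. The later
        split on \<open>b'\<close> is due to the correction term at \<open>(a, b')\<close>, which is
        0 for \<open>b' = 0\<close>.\<close>
      moreover note less(1)[of a' b] less(1)[of a b']
      ultimately show ?thesis using le le' a Suc
        by (cases b') (auto simp: algebra_simps)
    qed
  qed
qed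

section \<open>Excursions through their suffixes\<close>

lemma weakly_above_iff:
  assumes "k > 0"
  shows "weakly_above k p \<longleftrightarrow>
    (\<forall>m \<le> length p. fst (sum_list (take m p)) \<le> int k * snd (sum_list (take m p)))"
proof -
  have "real_of_int x / real k \<le> real_of_int y \<longleftrightarrow> x \<le> int k * y" for x y
  proof -
    have "real_of_int x / real k \<le> real_of_int y \<longleftrightarrow> real_of_int x \<le> real_of_int (int k * y)"
      using assms by (simp add: field_simps)
    then show ?thesis by (simp only: of_int_le_iff)
  qed
  then show ?thesis by (simp add: weakly_above_def case_prod_unfold)
qed

text \<open>The endpoint lies on the line \<open>x = k y\<close>, and prefix and suffix add up to
  it; so a prefix is weakly above the line iff the complementary suffix is weakly below.\<close>

lemma excursions_eq_suffix_paths: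
  assumes "k > 0"
  shows "excursions k n = suffix_paths k (k * n) n"
proof -
  have "fst (sum_list (take m p)) \<le> int k * snd (sum_list (take m p)) \<longleftrightarrow>
      int k * snd (sum_list (drop m p)) \<le> fst (sum_list (drop m p))"
    if "p \<in> paths (k * n) n" for p m
  proof -
    have "sum_list (take m p) + sum_list (drop m p) = (int (k * n), int n)"
      using that by (simp add: paths_def flip: sum_list_append)
    then have fst_take: "fst (sum_list (take m p)) = int k * int n - fst (sum_list (drop m p))"
      and snd_take: "snd (sum_list (take m p)) = int n - snd (sum_list (drop m p))"
      by (auto simp: prod_eq_iff)
    show ?thesis unfolding fst_take snd_take by (simp add: algebra_simps)
  qed
  then show ?thesis
    by (auto simp: excursions_def suffix_paths_def bridges_eq_paths weakly_above_iff[OF assms])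
qed

section \<open>Cutting at the first crossing\<close>

text \<open>The endpoint is strictly below the line, so some step crosses it first. That step goes
  right and starts on the line, hence the part before it is an excursion and the part after it a
  bridge.\<close>

lemma first_passage:
  assumes "k > 0" and p: "p \<in> paths (k * n + 1) n"
  shows "\<exists>i \<le> n. \<exists>q \<in> excursions k i. \<exists>r \<in> bridges k (n - i). p = q @ (1, 0) # r"
proof -
  define above where
    "above m \<longleftrightarrow> fst (sum_list (take m p)) \<le> int k * snd (sum_list (take m p))" for m
  have path: "lattice_path p" and total: "sum_list p = (int (k * n + 1), int n)"
    using p by (auto simp: paths_def)
  have "\<not> above (length p)" by (simp add: above_def total)
  moreover have "above 0" by (simp add: above_def)
  \<comment> \<open>The step \<open>p ! m\<close> is the first one to end below the line.\<close>
  ultimately obtain m where m: "m < length p" "\<forall>j \<le> m. above j" "\<not> above (Suc m)"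
    using ex_least_nat_less[of "\<lambda>j. \<not> above j" "length p"] by auto
  define q where "q = take m p"
  define r where "r = drop (Suc m) p"
  have p_eq: "p = q @ p ! m # r"
    using m(1) by (simp add: q_def r_def id_take_nth_drop)
  have "lattice_path q" "lattice_path r"
    using path by (simp_all add: q_def r_def lattice_path_take lattice_path_drop)
  then obtain x y x' y' where q: "q \<in> paths x y" and r: "r \<in> paths x' y'"
    by (meson lattice_path_in_paths)
  have take_Suc: "take (Suc m) p = q @ [p ! m]"
    using m(1) by (simp add: q_def take_Suc_conv_app_nth)
  have step: "p ! m = (1, 0) \<or> p ! m = (0, 1)"
    using path by (subst (asm) p_eq) simp
  have x_le: "int x \<le> int k * int y"
    using m(2) q by (auto simp: above_def q_def[symmetric] paths_def dest!: spec[of _ m])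
  have x_gt: "int x + fst (p ! m) > int k * (int y + snd (p ! m))"
    using m(3) q by (simp add: above_def take_Suc paths_def)
  \<comment> \<open>An up step preserves \<open>x \<le> k y\<close>, so it cannot cross. For a right
    step, \<open>x \<le> k y < x + 1\<close> forces equality over the integers.\<close>
  have right: "p ! m = (1, 0)"
    using step x_le x_gt by (auto simp: algebra_simps)
  with x_le x_gt have x: "int x = int k * int y" by simp
  then have x_nat: "x = k * y" by (metis of_nat_eq_iff of_nat_mult)
  have "sum_list q + (p ! m + sum_list r) = (int (k * n + 1), int n)"
    using total by (subst (asm) p_eq) simp
  with q r right have sums: "x + x' = k * n" "y + y' = n"
    by (auto simp: paths_def simp flip: of_nat_add of_nat_mult)
  then have "x' = k * y'" using x_nat by (simp flip: sums(2) add: algebra_simps)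
  with r sums have "r \<in> bridges k (n - y)" by (auto simp: bridges_eq_paths)
  moreover have "q \<in> excursions k y"
    using q x_nat m(1,2)
    by (auto simp: excursions_def bridges_eq_paths weakly_above_iff[OF assms(1)] above_def q_def min_def)
  ultimately show ?thesis using p_eq right sums(2) by (metis le_add1)
qed

text \<open>Uniqueness of the cut: if \<open>q\<close> were shorter than \<open>q'\<close>, then
  \<open>q\<close> followed by a right step would be a prefix of \<open>q'\<close>; but
  \<open>q\<close> ends on the line, so this prefix lies below it. Symmetry gives equal
  lengths.\<close>

lemma excursion_right_append_length_le:
  assumes "k > 0" and q: "q \<in> excursions k i" and q': "q' \<in> excursions k i'"
    and eq: "q @ (1, 0) # r = q' @ (1, 0) # r'"
  shows "length q' \<le> length q"
proof (rule ccontr)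
  assume "\<not> length q' \<le> length q"
  then have less: "length q < length q'" by simp
  have "take (Suc (length q)) q' = take (Suc (length q)) (q' @ (1, 0) # r')"
    using less by simp
  also have "\<dots> = q @ [(1, 0)]" by (simp flip: eq)
  finally have "fst (sum_list (q @ [(1, 0)])) \<le> int k * snd (sum_list (q @ [(1, 0)]))"
    using q' less unfolding excursions_def weakly_above_iff[OF assms(1)]
    by (auto dest!: spec[of _ "Suc (length q)"])
  then show False using q by (simp add: excursions_def bridges_def)
qed

text \<open>Gluing an excursion and a bridge with a right step is a bijection onto the paths to
  \<open>(k * n + 1, n)\<close>.\<close>

lemma excursion_bridge_convolution:
  assumes "k > 0"
  shows "(\<Sum>i=0..n. excursion_count k i * bridge_count k (n - i)) = (k * n + n + 1) choose n"
proof -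
  define S where "S = (SIGMA i:{0..n}. excursions k i \<times> bridges k (n - i))"
  define glue :: "nat \<times> (int \<times> int) list \<times> (int \<times> int) list \<Rightarrow> (int \<times> int) list"
    where "glue = (\<lambda>(i, q, r). q @ (1, 0) # r)"
  have fin: "finite (excursions k i)" "finite (bridges k i)" for i
    by (simp_all add: excursions_def bridges_eq_paths)
  have "inj_on glue S"
  proof (rule inj_onI, clarsimp simp: S_def glue_def)
    fix i q r i' q' r'
    assume q: "q \<in> excursions k i" and q': "q' \<in> excursions k i'"
      and eq: "q @ (1, 0) # r = q' @ (1, 0) # r'"
    then have "length q = length q'"
      using excursion_right_append_length_le[OF assms] by (metis le_antisym)
    with eq have "q = q'" "r = r'" by auto
    \<comment> \<open>The index \<open>i\<close> is recovered as the height of the endpoint of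
      \<open>q\<close>.\<close>
    with q q' show "i = i' \<and> q = q' \<and> r = r'"
      by (auto simp: excursions_def bridges_def)
  qed
  moreover have "glue ` S = paths (k * n + 1) n"
  proof (intro equalityI subsetI)
    fix p assume "p \<in> glue ` S"
    then obtain i q r where i: "i \<le> n" and "q \<in> excursions k i" "r \<in> bridges k (n - i)"
      and "p = q @ (1, 0) # r"
      by (auto simp: S_def glue_def)
    moreover have "int k * int i + int k * int (n - i) = int k * int n"
      using i by (simp add: of_nat_diff algebra_simps)
    ultimately show "p \<in> paths (k * n + 1) n"
      by (auto simp: excursions_def bridges_def paths_def of_nat_diff)
  next
    fix p assume "p \<in> paths (k * n + 1) n"
    from first_passage[OF assms this] show "p \<in> glue ` S"
      by (force simp: S_def glue_def)
  qed
  ultimately have "card S = card (paths (k * n + 1) n)"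
    by (metis card_image)
  moreover have "card S = (\<Sum>i=0..n. excursion_count k i * bridge_count k (n - i))"
    using fin by (simp add: S_def card_cartesian_product excursion_count_def bridge_count_def)
  ultimately show ?thesis by (simp add: card_paths algebra_simps)
qed

section \<open>From counts to generating functions\<close>

text \<open>With \<open>N = k * n + n\<close>, Pascal's rule splits the convolution
  \<open>(N + 1) choose n\<close> into \<open>N choose n\<close> and
  \<open>N choose (n - 1)\<close>; \<open>k\<close> times the latter cancels the correction term in
  the excursion count.\<close>

lemma bridge_count_convolution:
  assumes "k > 0"
  shows "(k + 1) * bridge_count k n =
    excursion_count k n + k * (\<Sum>i=0..n. excursion_count k i * bridge_count k (n - i))"
proof -
  have "bridge_count k n = (k * n + n) choose n"
    by (simp add: bridge_count_def bridges_eq_paths card_paths)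
  moreover have "excursion_count k n + (if n = 0 then 0 else k * ((k * n + n) choose (n - 1)))
      = (k * n + n) choose n"
    using card_suffix_paths[of k n "k * n"] assms
    by (simp add: excursion_count_def excursions_eq_suffix_paths)
  ultimately show ?thesis
    unfolding excursion_bridge_convolution[OF assms]
    by (cases n) (simp_all add: algebra_simps)
qed

theorem corollary13:
  fixes k :: nat
  assumes "k > 0"
  shows "bridge_gf k = excursion_gf k / (of_nat (k + 1) - of_nat k * excursion_gf k)"
proof -
  let ?D = "of_nat (k + 1) - of_nat k * excursion_gf k"
  have "of_nat (k + 1) * bridge_gf k = excursion_gf k + of_nat k * (excursion_gf k * bridge_gf k)"
  proof (rule fps_ext)
    fix n
    have "(of_nat ((k + 1) * bridge_count k n) :: rat) = of_nat (excursion_count k n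
        + k * (\<Sum>i=0..n. excursion_count k i * bridge_count k (n - i)))"
      by (simp only: bridge_count_convolution[OF assms])
    then show "fps_nth (of_nat (k + 1) * bridge_gf k) n
        = fps_nth (excursion_gf k + of_nat k * (excursion_gf k * bridge_gf k)) n"
      unfolding fps_add_nth fps_mult_of_nat_nth
      by (simp add: bridge_gf_def excursion_gf_def fps_mult_nth distrib_right)
  qed
  then have "bridge_gf k * ?D = excursion_gf k" by (simp add: algebra_simps)
  \<comment> \<open>Cancelling the factor \<open>?D\<close> in the quotient requires it to be
    nonzero. If it vanished, so would \<open>excursion_gf k\<close>, leaving \<open>?D\<close> equal
    to the nonzero constant \<open>k + 1\<close>.\<close>
  moreover have "?D \<noteq> 0"
  proof
    assume "?D = 0"
    with \<open>bridge_gf k * ?D = excursion_gf k\<close> have "excursion_gf k = 0" by simp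
    with \<open>?D = 0\<close> show False by (simp flip: of_nat_Suc)
  qed
  ultimately show ?thesis by (metis nonzero_mult_div_cancel_right)
qed

end
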